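(* Let $n\ge3$ and let $\mathcal{A}\subset\ell_1^n\setminus\{0\}$ be a compact set. Then $\mathcal{A}$ admits a ball covering consisting of $n+1$ balls. In particular, $S_{\ell_1^n}$ admits a ball covering consisting of $n+1$ balls for any $n\ge3$.
   Context: $\ell_1^n$ is $\mathbb{R}^n$ with the norm $\|x\|=\sum_{i=1}^n|x_i|$ and $S_{\ell_1^n}$ is its unit sphere. A subset $\mathcal{A}$ of a normed space $\mathbb{X}$ admits a ball covering consisting of $k$ balls if there are $x_1,\dots,x_k\in\mathbb{X}\setminus\{0\}$ and $0<r_i\le\|x_i\|$ with $\mathcal{A}\subseteq\bigcup_{i=1}^k B(x_i,r_i)$, where $B(x,r)$ is the open ball of center $x$ and radius $r$. *)

theory Defs
  imports "HOL-Analysis.Analysis"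
begin

text \<open>
  The type \<open>'n ell1\<close>, for a finite index type \<open>'n\<close> with \<open>n\<close> elements, is the space of real
  vectors indexed by \<open>'n\<close> with the sum norm. It is a separate type because \<open>real ^ 'n\<close>
  already carries the Euclidean norm. The distance and the topology are the ones induced by the
  sum norm, so the library notions \<open>ball\<close>, \<open>sphere\<close> and \<open>compact\<close> refer to that norm.
\<close>

typedef 'n ell1 = "UNIV :: ('n \<Rightarrow> real) set"
  morphisms coord Ell1
  by simp

lemma coord_Ell1 [simp]: "coord (Ell1 f) = f"
  by (simp add: Ell1_inverse)

lemma ell1_eq_iff: "x = y \<longleftrightarrow> (\<forall>i. coord x i = coord y i)"
  by (metis coord_inject ext)

instantiation ell1 :: (type) real_vector
begin

definition zero_ell1 :: "'a ell1"
  where "0 = Ell1 (\<lambda>i. 0)"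

definition plus_ell1 :: "'a ell1 \<Rightarrow> 'a ell1 \<Rightarrow> 'a ell1"
  where "x + y = Ell1 (\<lambda>i. coord x i + coord y i)"

definition minus_ell1 :: "'a ell1 \<Rightarrow> 'a ell1 \<Rightarrow> 'a ell1"
  where "x - y = Ell1 (\<lambda>i. coord x i - coord y i)"

definition uminus_ell1 :: "'a ell1 \<Rightarrow> 'a ell1"
  where "- x = Ell1 (\<lambda>i. - coord x i)"

definition scaleR_ell1 :: "real \<Rightarrow> 'a ell1 \<Rightarrow> 'a ell1"
  where "c *\<^sub>R x = Ell1 (\<lambda>i. c * coord x i)"

instance
  by standard
    (simp_all add: ell1_eq_iff zero_ell1_def plus_ell1_def minus_ell1_def uminus_ell1_def
      scaleR_ell1_def algebra_simps)

end

lemma coord_simps [simp]: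
  "coord 0 i = 0"
  "coord (x + y) i = coord x i + coord y i"
  "coord (x - y) i = coord x i - coord y i"
  "coord (- x) i = - coord x i"
  "coord (c *\<^sub>R x) i = c * coord x i"
  by (simp_all add: zero_ell1_def plus_ell1_def minus_ell1_def uminus_ell1_def scaleR_ell1_def)

instantiation ell1 :: (finite) real_normed_vector
begin

definition norm_ell1 :: "'a ell1 \<Rightarrow> real"
  where "norm x = (\<Sum>i\<in>UNIV. \<bar>coord x i\<bar>)"

definition sgn_ell1 :: "'a ell1 \<Rightarrow> 'a ell1"
  where "sgn (x :: 'a ell1) = x /\<^sub>R norm x"

definition dist_ell1 :: "'a ell1 \<Rightarrow> 'a ell1 \<Rightarrow> real"
  where "dist x y = norm (x - y :: 'a ell1)"

definition uniformity_ell1 :: "('a ell1 \<times> 'a ell1) filter"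
  where "uniformity = (INF e\<in>{0<..}. principal {(x, y :: 'a ell1). dist x y < e})"

definition open_ell1 :: "'a ell1 set \<Rightarrow> bool"
  where "open (U :: 'a ell1 set) \<longleftrightarrow> (\<forall>x\<in>U. \<forall>\<^sub>F (x', y) in uniformity. x' = x \<longrightarrow> y \<in> U)"

instance
proof
  fix x y :: "'a ell1" and c :: real
  show "norm x = 0 \<longleftrightarrow> x = 0"
    by (simp add: norm_ell1_def ell1_eq_iff sum_nonneg_eq_0_iff)
  show "norm (x + y) \<le> norm x + norm y"
    unfolding norm_ell1_def sum.distrib [symmetric]
    by (rule sum_mono) (simp add: abs_triangle_ineq)
  show "norm (c *\<^sub>R x) = \<bar>c\<bar> * norm x"
    by (simp add: norm_ell1_def abs_mult sum_distrib_left)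
qed (simp_all add: sgn_ell1_def dist_ell1_def uniformity_ell1_def open_ell1_def)

end

text \<open>The balls form an indexed family; repetitions are allowed.\<close>

definition admits_ball_covering :: "'a::real_normed_vector set \<Rightarrow> nat \<Rightarrow> bool"
  where "admits_ball_covering A k \<longleftrightarrow>
    (\<exists>(x :: nat \<Rightarrow> 'a) (r :: nat \<Rightarrow> real).
      (\<forall>i\<in>{1..k}. x i \<noteq> 0 \<and> 0 < r i \<and> r i \<le> norm (x i)) \<and>
      A \<subseteq> (\<Union>i\<in>{1..k}. ball (x i) (r i)))"

end

theory Submission imports Defs begin

text \<open>
  Let \<open>\<sigma>\<close> be a vector all of whose coordinates are \<open>1\<close> or \<open>-1\<close>. The balls of center \<open>t \<sigma>\<close> and
  radius \<open>\<parallel>t \<sigma>\<parallel> = t n\<close> grow with \<open>t > 0\<close>, and they exhaust the half-space of those \<open>y\<close> with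
  \<open>(\<Sum>i. \<sigma>\<^sub>i y\<^sub>i) > 0\<close>. More precisely, as soon as \<open>t\<close> dominates all the \<open>\<bar>y\<^sub>i\<bar>\<close>, the distance
  from \<open>y\<close> to \<open>t \<sigma>\<close> is exactly \<open>t n - (\<Sum>i. \<sigma>\<^sub>i y\<^sub>i)\<close> (\<open>norm_diff_sign_vector\<close>). So one value of
  \<open>t\<close> serves for a whole bounded set, and the problem reduces to finding \<open>n + 1\<close> sign vectors
  whose open half-spaces cover everything except the origin.

  Such a family consists of the constant vector \<open>-1\<close> and the \<open>n\<close> vectors obtained from the
  constant vector \<open>1\<close> by flipping one sign (\<open>half_spaces_cover\<close>). The latter sum to
  \<open>(n - 2) 1\<close>, so for \<open>n \<ge> 3\<close> the origin is a positive combination of all \<open>n + 1\<close> vectors;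
  since they also span the space, no nonzero \<open>y\<close> has a nonpositive pairing with each of them.
  For \<open>n = 2\<close> the two flipped vectors are opposite and the argument breaks down.
\<close>

lemma norm_sign_vector:
  fixes x :: "'n::finite ell1"
  assumes "\<And>i. \<bar>coord x i\<bar> = 1"
  shows "norm x = CARD('n)"
  by (simp add: norm_ell1_def assms)

lemma abs_coord_le_norm: "\<bar>coord x i\<bar> \<le> norm (x :: 'n::finite ell1)"
  unfolding norm_ell1_def by (rule member_le_sum) auto

text \<open>
  Once \<open>t\<close> dominates the coordinates of \<open>y\<close>, every coordinate of \<open>t \<sigma> - y\<close> has the sign
  prescribed by \<open>\<sigma>\<close> (or vanishes), so the norm is linear in \<open>y\<close> there.
\<close>

lemma norm_diff_sign_vector:
  fixes \<sigma> y :: "'n::finite ell1"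
  assumes \<sigma>: "\<And>i. \<bar>coord \<sigma> i\<bar> = 1" and t: "norm y \<le> t"
  shows "norm (t *\<^sub>R \<sigma> - y) = t * CARD('n) - (\<Sum>i\<in>UNIV. coord \<sigma> i * coord y i)"
proof -
  have "\<bar>t * coord \<sigma> i - coord y i\<bar> = t - coord \<sigma> i * coord y i" for i
  proof -
    have "coord \<sigma> i = 1 \<or> coord \<sigma> i = -1"
      using \<sigma>[of i] by linarith
    then show ?thesis
      using abs_coord_le_norm[of y i] t by auto
  qed
  then show ?thesis
    by (simp add: norm_ell1_def sum_subtractf)
qed

definition flipped_ones :: "'n \<Rightarrow> 'n ell1"
  where "flipped_ones j = Ell1 (\<lambda>i. if i = j then -1 else 1)"

definition minus_ones :: "'n ell1"
  where "minus_ones = Ell1 (\<lambda>i. -1)"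

lemma pairing_flipped_ones:
  "(\<Sum>i\<in>UNIV. coord (flipped_ones j) i * coord y i)
    = (\<Sum>i\<in>UNIV. coord y i) - 2 * coord y (j :: 'n::finite)"
proof -
  have "(\<Sum>i\<in>UNIV. coord (flipped_ones j) i * coord y i)
      = (\<Sum>i\<in>UNIV. coord y i - (if i = j then 2 * coord y i else 0))"
    by (rule sum.cong) (auto simp: flipped_ones_def)
  then show ?thesis
    by (simp add: sum_subtractf)
qed

text \<open>
  Write \<open>s\<close> for the coordinate sum of \<open>y\<close>. If all pairings are nonpositive, then \<open>s \<ge> 0\<close> and
  \<open>s \<le> 2 y\<^sub>j\<close> for each \<open>j\<close>. Adding up the latter gives \<open>n s \<le> 2 s\<close>, hence \<open>s = 0\<close>; then all
  coordinates are nonnegative with sum \<open>0\<close>.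
\<close>

lemma half_spaces_cover:
  fixes y :: "'n::finite ell1"
  assumes n: "CARD('n) \<ge> 3" and y: "y \<noteq> 0"
  shows "\<exists>\<sigma> \<in> insert minus_ones (range flipped_ones). (\<Sum>i\<in>UNIV. coord \<sigma> i * coord y i) > 0"
proof (rule ccontr)
  assume "\<not> ?thesis"
  then have nonpos: "(\<Sum>i\<in>UNIV. coord \<sigma> i * coord y i) \<le> 0"
    if "\<sigma> \<in> insert minus_ones (range flipped_ones)" for \<sigma>
    using that by (meson not_le_imp_less)
  define s where "s = (\<Sum>i\<in>UNIV. coord y i)"
  have "s \<ge> 0"
    using nonpos[of minus_ones] by (simp add: minus_ones_def s_def sum_negf)
  have le: "s \<le> 2 * coord y j" for j
    using nonpos[of "flipped_ones j"] by (simp add: pairing_flipped_ones s_def)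
  have "real CARD('n) * s \<le> 2 * s"
    using sum_mono[of "UNIV :: 'n set" "\<lambda>_. s" "\<lambda>j. 2 * coord y j"] le
    by (simp add: s_def sum_distrib_left)
  moreover have "3 * s \<le> real CARD('n) * s"
    using n \<open>s \<ge> 0\<close> by (intro mult_right_mono) auto
  ultimately have "s = 0"
    using \<open>s \<ge> 0\<close> by linarith
  then have "coord y j = 0" for j
    using le by (simp add: s_def sum_nonneg_eq_0_iff)
  then show False
    using y by (simp add: ell1_eq_iff)
qed

lemma bounded_admits_ball_covering:
  fixes A :: "'n::finite ell1 set"
  assumes n: "CARD('n) \<ge> 3" and A: "bounded A" "0 \<notin> A"
  shows "admits_ball_covering A (CARD('n) + 1)"
proof -
  obtain t where t: "t > 0" "\<And>y. y \<in> A \<Longrightarrow> norm y \<le> t"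
    using A(1) by (auto simp: bounded_pos)
  obtain h :: "nat \<Rightarrow> 'n" where h: "bij_betw h {1..CARD('n)} UNIV"
    using ex_bij_betw_nat_finite_1[of "UNIV :: 'n set"] by auto
  define \<sigma> where "\<sigma> k = (if k \<le> CARD('n) then flipped_ones (h k) else minus_ones)" for k
  have signs: "\<bar>coord (\<sigma> k) i\<bar> = 1" for k i
    by (simp add: \<sigma>_def flipped_ones_def minus_ones_def)
  have norm_center: "norm (t *\<^sub>R \<sigma> k) = t * CARD('n)" for k
    using t(1) by (simp add: norm_sign_vector signs)
  have image: "insert minus_ones (range flipped_ones) \<subseteq> \<sigma> ` {1..CARD('n) + 1}"
  proof -
    have "minus_ones = \<sigma> (CARD('n) + 1)"
      by (simp add: \<sigma>_def)
    moreover have "flipped_ones j \<in> \<sigma> ` {1..CARD('n) + 1}" for j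
    proof -
      have "j \<in> h ` {1..CARD('n)}"
        using h by (simp add: bij_betw_def)
      then obtain k where "k \<in> {1..CARD('n)}" "j = h k"
        by blast
      then show ?thesis
        by (intro image_eqI[of _ _ k]) (auto simp: \<sigma>_def)
    qed
    ultimately show ?thesis
      by auto
  qed
  have "A \<subseteq> (\<Union>k\<in>{1..CARD('n) + 1}. ball (t *\<^sub>R \<sigma> k) (t * CARD('n)))"
  proof
    fix y assume "y \<in> A"
    then have "y \<noteq> 0"
      using A(2) by auto
    then obtain \<tau> where "\<tau> \<in> insert minus_ones (range flipped_ones)"
      and \<tau>: "(\<Sum>i\<in>UNIV. coord \<tau> i * coord y i) > 0"
      using half_spaces_cover[OF n, of y] by blast
    then obtain k where k: "k \<in> {1..CARD('n) + 1}" and "\<tau> = \<sigma> k"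
      using image by blast
    then have pos: "(\<Sum>i\<in>UNIV. coord (\<sigma> k) i * coord y i) > 0"
      using \<tau> by simp
    have "dist (t *\<^sub>R \<sigma> k) y < t * CARD('n)"
      using pos norm_diff_sign_vector[OF signs t(2)[OF \<open>y \<in> A\<close>]] by (simp add: dist_norm)
    then show "y \<in> (\<Union>k\<in>{1..CARD('n) + 1}. ball (t *\<^sub>R \<sigma> k) (t * CARD('n)))"
      using k by auto
  qed
  moreover have radius: "0 < t * CARD('n)"
    using t(1) by simp
  moreover have "t *\<^sub>R \<sigma> k \<noteq> 0" for k
    using norm_center[of k] radius by force
  ultimately show ?thesis
    unfolding admits_ball_covering_def
    by (intro exI[of _ "\<lambda>k. t *\<^sub>R \<sigma> k"] exI[of _ "\<lambda>_. t * CARD('n)"])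
      (simp only: norm_center, simp)
qed

theorem corollary3p27:
  assumes "CARD('n::finite) \<ge> 3"
  shows "(\<forall>A :: 'n ell1 set. A \<subseteq> UNIV - {0} \<and> compact A \<longrightarrow>
            admits_ball_covering A (CARD('n) + 1)) \<and>
         admits_ball_covering (sphere (0 :: 'n ell1) 1) (CARD('n) + 1)"
proof (intro conjI allI impI)
  fix A :: "'n ell1 set"
  assume "A \<subseteq> UNIV - {0} \<and> compact A"
  then show "admits_ball_covering A (CARD('n) + 1)"
    by (intro bounded_admits_ball_covering assms) (auto simp: compact_imp_bounded)
next
  show "admits_ball_covering (sphere (0 :: 'n ell1) 1) (CARD('n) + 1)"
    by (intro bounded_admits_ball_covering assms) (auto simp: bounded_iff)
qed

end
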